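(* Let $M$ be a monoid, $\Omega$ the subobject classifier of $\mathbf{PSh}(M)$, $\Gamma, C : \mathbf{PSh}(M) \to \mathbf{Set}$ the global sections and connected components functors, and $\alpha : \Gamma \to C$ the canonical natural transformation. The following are equivalent: (1) $C$ preserves monomorphisms, i.e. the terminal left $M$-set is monomorphism-flat. (2) Any two non-empty sub-$M$-sets of an indecomposable right $M$-set have non-empty intersection. (3) $M$ satisfies the right Ore condition. (4) Any sub-$M$-set of an indecomposable right $M$-set is either empty or indecomposable. (5) $C(\Omega)$ is a two-element set (combined with condition (1), this means that $C$ preserves the subobject classifier). (6) $\mathbf{PSh}(M)$ is de Morgan. (7) $\alpha : \Gamma \to C$ is a monomorphism; that is, $\mathbf{PSh}(M)$ is copunctually locally connected.
   Context: For a monoid $M$, $\mathbf{PSh}(M)$ denotes the category of right $M$-sets (the empty one included) and $M$-equivariant maps. $\Delta : \mathbf{Set} \to \mathbf{PSh}(M)$ sends a set to itself with trivial action. Its right adjoint $\Gamma$ sends $X$ to the set of fixed points $\{x \in X : xm = x \ \forall m \in M\}$; its left adjoint $C$ sends $X$ to the quotient of $X$ by the equivalence relation generated by $x \sim xm$ ($x\in X$, $m \in M$), i.e. $C(X) \cong X \otimes_M 1$ with $1$ the terminal left $M$-set. The natural transformation $\alpha : \Gamma \to C$ sends a fixed point of $X$ to the connected component of $X$ containing it; the topos is copunctually locally connected if $\alpha$ is a monomorphism. A left $M$-set $B$ is monomorphism-flat if $-\otimes_M B : \mathbf{PSh}(M) \to \mathbf{Set}$ preserves monomorphisms. A right $M$-set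 $X$ is indecomposable if it is non-empty and $X \cong X_1 \sqcup X_2$ implies $X_1$ or $X_2$ is empty (equivalently $|C(X)| = 1$). $\Omega$ is the set of right ideals of $M$ (including $\varnothing$) with action $I \cdot m = \{m' \in M : mm' \in I\}$. A monomorphism-preserving functor $F$ between toposes preserves the subobject classifier if the map $F(\Omega) \to \Omega$ classifying $F(\top)$ is an isomorphism. $M$ satisfies the right Ore condition if for all $m_1,m_2 \in M$ there exist $m_1', m_2' \in M$ with $m_1m_1' = m_2m_2'$. A topos is de Morgan if its subobject classifier is de Morgan as an internal Heyting algebra; equivalently, for any subobject $A$ of an object $B$, $(A \to 0) \cup ((A \to 0)\to 0) = B$ in the Heyting algebra of subobjects of $B$. *)

theory Defs
  imports "HOL-Algebra.Group"
begin

section \<open>Actions of a monoid\<close>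

record ('a, 'm) right_act = "'a partial_object" +
  ract :: "'a \<Rightarrow> 'm \<Rightarrow> 'a"

record ('a, 'm) left_act = "'a partial_object" +
  lact :: "'m \<Rightarrow> 'a \<Rightarrow> 'a"

locale right_mset = monoid M
  for M :: "('m, 'k) monoid_scheme" (structure) and X :: "('a, 'm) right_act" +
  assumes ract_closed: "x \<in> carrier X \<Longrightarrow> m \<in> carrier M \<Longrightarrow> ract X x m \<in> carrier X"
    and ract_one: "x \<in> carrier X \<Longrightarrow> ract X x \<one> = x"
    and ract_mult: "x \<in> carrier X \<Longrightarrow> m \<in> carrier M \<Longrightarrow> n \<in> carrier M \<Longrightarrow>
          ract X x (m \<otimes> n) = ract X (ract X x m) n"

locale left_mset = monoid M
  for M :: "('m, 'k) monoid_scheme" (structure) and B :: "('b, 'm) left_act" +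
  assumes lact_closed: "b \<in> carrier B \<Longrightarrow> m \<in> carrier M \<Longrightarrow> lact B m b \<in> carrier B"
    and lact_one: "b \<in> carrier B \<Longrightarrow> lact B \<one> b = b"
    and lact_mult: "b \<in> carrier B \<Longrightarrow> m \<in> carrier M \<Longrightarrow> n \<in> carrier M \<Longrightarrow>
          lact B (m \<otimes> n) b = lact B m (lact B n b)"

text \<open>The objects and morphisms of the presheaf topos on \<open>M\<close>.  As there is no quantification
  over types, objects are \<open>M\<close>-sets whose elements are drawn from a type \<open>'u\<close>, which is passed as
  a type argument where it does not occur otherwise.  Results are stated for every type \<open>'u\<close>
  into which \<open>M\<close> itself embeds, so that the regular \<open>M\<close>-set is available.  Morphisms are only relevant on the carrier
  of their domain.\<close>

definition mset_hom ::
  "('m, 'k) monoid_scheme \<Rightarrow> ('a, 'm) right_act \<Rightarrow> ('b, 'm) right_act \<Rightarrow> ('a \<Rightarrow> 'b) set" where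
  "mset_hom M X Y = {f \<in> carrier X \<rightarrow> carrier Y.
     \<forall>x\<in>carrier X. \<forall>m\<in>carrier M. f (ract X x m) = ract Y (f x) m}"

definition mset_isomorphic ::
  "('m, 'k) monoid_scheme \<Rightarrow> ('a, 'm) right_act \<Rightarrow> ('b, 'm) right_act \<Rightarrow> bool" where
  "mset_isomorphic M X Y \<longleftrightarrow> (\<exists>f \<in> mset_hom M X Y. bij_betw f (carrier X) (carrier Y))"

text \<open>Monomorphisms of right \<open>M\<close>-sets, in the categorical sense of left-cancellable morphisms;
  the lemma \<open>mset_mono_iff\<close> below shows that these are the injective ones.\<close>

definition mset_mono ::
  "('m, 'k) monoid_scheme \<Rightarrow> ('u, 'm) right_act \<Rightarrow> ('u, 'm) right_act \<Rightarrow> ('u \<Rightarrow> 'u) \<Rightarrow> bool" where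
  "mset_mono M X Y f \<longleftrightarrow> f \<in> mset_hom M X Y \<and>
     (\<forall>(Z :: ('u, 'm) right_act) g h.
        right_mset M Z \<and> g \<in> mset_hom M Z X \<and> h \<in> mset_hom M Z X \<and>
        (\<forall>z\<in>carrier Z. f (g z) = f (h z)) \<longrightarrow> (\<forall>z\<in>carrier Z. g z = h z))"

definition sub_mset ::
  "('m, 'k) monoid_scheme \<Rightarrow> ('a, 'm) right_act \<Rightarrow> 'a set \<Rightarrow> bool" where
  "sub_mset M X A \<longleftrightarrow> A \<subseteq> carrier X \<and> (\<forall>x\<in>A. \<forall>m\<in>carrier M. ract X x m \<in> A)"

definition restrict_mset :: "('a, 'm) right_act \<Rightarrow> 'a set \<Rightarrow> ('a, 'm) right_act" where
  "restrict_mset X A = X\<lparr>carrier := A\<rparr>"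

definition mset_coprod ::
  "('a, 'm) right_act \<Rightarrow> ('b, 'm) right_act \<Rightarrow> ('a + 'b, 'm) right_act" where
  "mset_coprod X Y = \<lparr>carrier = carrier X <+> carrier Y,
     ract = (\<lambda>z m. case z of Inl x \<Rightarrow> Inl (ract X x m) | Inr y \<Rightarrow> Inr (ract Y y m))\<rparr>"

text \<open>The summands may be taken from the same type \<open>'u\<close> as \<open>X\<close>, since they embed in \<open>X\<close>.\<close>

definition indecomposable :: "('m, 'k) monoid_scheme \<Rightarrow> ('u, 'm) right_act \<Rightarrow> bool" where
  "indecomposable M X \<longleftrightarrow> carrier X \<noteq> {} \<and>
     (\<forall>(X\<^sub>1 :: ('u, 'm) right_act) (X\<^sub>2 :: ('u, 'm) right_act).
        right_mset M X\<^sub>1 \<and> right_mset M X\<^sub>2 \<and> mset_isomorphic M X (mset_coprod X\<^sub>1 X\<^sub>2) \<longrightarrow>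
        carrier X\<^sub>1 = {} \<or> carrier X\<^sub>2 = {})"

definition terminal_right :: "(unit, 'm) right_act" where
  "terminal_right = \<lparr>carrier = {()}, ract = (\<lambda>_ _. ())\<rparr>"

definition terminal_left :: "(unit, 'm) left_act" where
  "terminal_left = \<lparr>carrier = {()}, lact = (\<lambda>_ _. ())\<rparr>"


section \<open>Global sections and connected components\<close>

text \<open>The equivalence relation on \<open>A\<close> generated by a relation \<open>r\<close> on \<open>A\<close>.\<close>

definition generated_equiv :: "'a set \<Rightarrow> 'a rel \<Rightarrow> 'a rel" where
  "generated_equiv A r = {(x, y). x \<in> A \<and> y \<in> A \<and> equivclp (\<lambda>u v. (u, v) \<in> r) x y}"

definition global_sections :: "('m, 'k) monoid_scheme \<Rightarrow> ('a, 'm) right_act \<Rightarrow> 'a set" where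
  "global_sections M X = {x \<in> carrier X. \<forall>m\<in>carrier M. ract X x m = x}"

definition conn_rel :: "('m, 'k) monoid_scheme \<Rightarrow> ('a, 'm) right_act \<Rightarrow> 'a rel" where
  "conn_rel M X = generated_equiv (carrier X)
     {(x, ract X x m) | x m. x \<in> carrier X \<and> m \<in> carrier M}"

definition components :: "('m, 'k) monoid_scheme \<Rightarrow> ('a, 'm) right_act \<Rightarrow> 'a set set" where
  "components M X = carrier X // conn_rel M X"

text \<open>The action of the connected components functor on a morphism \<open>f\<close> with codomain \<open>Y\<close>: the
  class of \<open>x\<close> is sent to the class of \<open>f x\<close>.\<close>

definition components_map ::
  "('m, 'k) monoid_scheme \<Rightarrow> ('b, 'm) right_act \<Rightarrow> ('a \<Rightarrow> 'b) \<Rightarrow> 'a set \<Rightarrow> 'b set" where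
  "components_map M Y f c = conn_rel M Y `` (f ` c)"

definition components_preserves_monos :: "'u itself \<Rightarrow> ('m, 'k) monoid_scheme \<Rightarrow> bool" where
  "components_preserves_monos _ M \<longleftrightarrow>
     (\<forall>(X :: ('u, 'm) right_act) (Y :: ('u, 'm) right_act) f.
        right_mset M X \<and> right_mset M Y \<and> mset_mono M X Y f \<longrightarrow>
        inj_on (components_map M Y f) (components M X))"

definition alpha :: "('m, 'k) monoid_scheme \<Rightarrow> ('a, 'm) right_act \<Rightarrow> 'a \<Rightarrow> 'a set" where
  "alpha M X x = conn_rel M X `` {x}"

text \<open>A natural transformation of set-valued functors is a monomorphism iff each of its components
  is injective.\<close>

definition copunctually_locally_connected :: "'u itself \<Rightarrow> ('m, 'k) monoid_scheme \<Rightarrow> bool" where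
  "copunctually_locally_connected _ M \<longleftrightarrow>
     (\<forall>X :: ('u, 'm) right_act. right_mset M X \<longrightarrow> inj_on (alpha M X) (global_sections M X))"


section \<open>Tensor products\<close>

definition tensor_rel ::
  "('m, 'k) monoid_scheme \<Rightarrow> ('a, 'm) right_act \<Rightarrow> ('b, 'm) left_act \<Rightarrow> ('a \<times> 'b) rel" where
  "tensor_rel M X B = generated_equiv (carrier X \<times> carrier B)
     {((ract X x m, b), (x, lact B m b)) | x m b.
        x \<in> carrier X \<and> m \<in> carrier M \<and> b \<in> carrier B}"

definition tensor ::
  "('m, 'k) monoid_scheme \<Rightarrow> ('a, 'm) right_act \<Rightarrow> ('b, 'm) left_act \<Rightarrow> ('a \<times> 'b) set set" where
  "tensor M X B = (carrier X \<times> carrier B) // tensor_rel M X B"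

definition tensor_map ::
  "('m, 'k) monoid_scheme \<Rightarrow> ('c, 'm) right_act \<Rightarrow> ('b, 'm) left_act \<Rightarrow> ('a \<Rightarrow> 'c) \<Rightarrow>
     ('a \<times> 'b) set \<Rightarrow> ('c \<times> 'b) set" where
  "tensor_map M Y B f c = tensor_rel M Y B `` (map_prod f id ` c)"

definition mono_flat :: "'u itself \<Rightarrow> ('m, 'k) monoid_scheme \<Rightarrow> ('b, 'm) left_act \<Rightarrow> bool" where
  "mono_flat _ M B \<longleftrightarrow> left_mset M B \<and>
     (\<forall>(X :: ('u, 'm) right_act) (Y :: ('u, 'm) right_act) f.
        right_mset M X \<and> right_mset M Y \<and> mset_mono M X Y f \<longrightarrow>
        inj_on (tensor_map M Y B f) (tensor M X B))"


section \<open>The subobject classifier\<close>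

definition right_ideal :: "('m, 'k) monoid_scheme \<Rightarrow> 'm set \<Rightarrow> bool" where
  "right_ideal M I \<longleftrightarrow> I \<subseteq> carrier M \<and> (\<forall>x\<in>I. \<forall>m\<in>carrier M. x \<otimes>\<^bsub>M\<^esub> m \<in> I)"

definition Omega :: "('m, 'k) monoid_scheme \<Rightarrow> ('m set, 'm) right_act" where
  "Omega M = \<lparr>carrier = {I. right_ideal M I},
     ract = (\<lambda>I m. {m' \<in> carrier M. m \<otimes>\<^bsub>M\<^esub> m' \<in> I})\<rparr>"

definition Omega_true :: "('m, 'k) monoid_scheme \<Rightarrow> unit \<Rightarrow> 'm set" where
  "Omega_true M = (\<lambda>_. carrier M)"

text \<open>In the category of sets the subobject classifier is \<open>bool\<close>, and an injection with image
  \<open>T \<subseteq> S\<close> is classified by \<open>\<lambda>s. s \<in> T\<close>.\<close>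

definition components_preserves_subobject_classifier ::
  "'u itself \<Rightarrow> ('m, 'k) monoid_scheme \<Rightarrow> bool" where
  "components_preserves_subobject_classifier U M \<longleftrightarrow>
     components_preserves_monos U M \<and>
     bij_betw (\<lambda>c. c \<in> components_map M (Omega M) (Omega_true M) ` components M terminal_right)
       (components M (Omega M)) (UNIV :: bool set)"

text \<open>The internal Heyting algebra structure of \<open>Omega M\<close>: the order is inclusion, meet and join are
  intersection and union, bottom is the empty ideal, top is the carrier of \<open>M\<close>; the implication is
  determined by adjointness, see \<open>Omega_imp_adjoint\<close>.\<close>

definition Omega_imp :: "('m, 'k) monoid_scheme \<Rightarrow> 'm set \<Rightarrow> 'm set \<Rightarrow> 'm set" where
  "Omega_imp M I J = {m \<in> carrier M. \<forall>n\<in>carrier M. m \<otimes>\<^bsub>M\<^esub> n \<in> I \<longrightarrow> m \<otimes>\<^bsub>M\<^esub> n \<in> J}"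

definition de_Morgan_topos :: "('m, 'k) monoid_scheme \<Rightarrow> bool" where
  "de_Morgan_topos M \<longleftrightarrow> (\<forall>I\<in>carrier (Omega M).
     Omega_imp M I {} \<union> Omega_imp M (Omega_imp M I {}) {} = carrier M)"

definition right_Ore :: "('m, 'k) monoid_scheme \<Rightarrow> bool" where
  "right_Ore M \<longleftrightarrow> (\<forall>m\<^sub>1\<in>carrier M. \<forall>m\<^sub>2\<in>carrier M.
     \<exists>m\<^sub>1'\<in>carrier M. \<exists>m\<^sub>2'\<in>carrier M. m\<^sub>1 \<otimes>\<^bsub>M\<^esub> m\<^sub>1' = m\<^sub>2 \<otimes>\<^bsub>M\<^esub> m\<^sub>2')"


section \<open>Basic facts\<close>

lemma (in monoid) right_mset_transport:
  assumes "inj_on \<iota> (carrier G)"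
  shows "right_mset G \<lparr>carrier = \<iota> ` carrier G,
           ract = (\<lambda>u m. \<iota> (inv_into (carrier G) \<iota> u \<otimes> m))\<rparr>"
  using assms by unfold_locales (auto simp: m_assoc)

lemma mset_mono_iff:
  fixes \<iota> :: "'m \<Rightarrow> 'u" and X :: "('u, 'm) right_act"
  assumes X: "right_mset M X" and \<iota>: "inj_on \<iota> (carrier M)"
  shows "mset_mono M X Y f \<longleftrightarrow> f \<in> mset_hom M X Y \<and> inj_on f (carrier X)"
proof
  assume mono: "mset_mono M X Y f"
  interpret right_mset M X by (rule X)
  let ?Z = "\<lparr>carrier = \<iota> ` carrier M, ract = (\<lambda>u m. \<iota> (inv_into (carrier M) \<iota> u \<otimes>\<^bsub>M\<^esub> m))\<rparr>"
  let ?g = "\<lambda>x u. ract X x (inv_into (carrier M) \<iota> u)"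
  from mono have f: "f \<in> mset_hom M X Y" by (simp add: mset_mono_def)
  have g: "?g x \<in> mset_hom M ?Z X" if "x \<in> carrier X" for x
    using that \<iota> by (auto simp: mset_hom_def ract_closed ract_mult)
  have "x = y" if xy: "x \<in> carrier X" "y \<in> carrier X" "f x = f y" for x y
  proof -
    have "f (?g x z) = f (?g y z)" if "z \<in> carrier ?Z" for z
      using that xy f \<iota> by (auto simp: mset_hom_def)
    moreover have "right_mset M ?Z" by (rule right_mset_transport[OF \<iota>])
    ultimately have "\<forall>z\<in>carrier ?Z. ?g x z = ?g y z"
      using mono g xy unfolding mset_mono_def by blast
    then have "?g x (\<iota> \<one>\<^bsub>M\<^esub>) = ?g y (\<iota> \<one>\<^bsub>M\<^esub>)" by auto
    then show "x = y" using xy \<iota> by (simp add: ract_one)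
  qed
  with f show "f \<in> mset_hom M X Y \<and> inj_on f (carrier X)" by (auto intro: inj_onI)
next
  assume "f \<in> mset_hom M X Y \<and> inj_on f (carrier X)"
  then show "mset_mono M X Y f"
    unfolding mset_mono_def mset_hom_def Pi_iff inj_on_def mem_Collect_eq by meson
qed

lemma (in monoid) right_mset_Omega: "right_mset G (Omega G)"
  by unfold_locales (auto simp: Omega_def right_ideal_def m_assoc)

text \<open>\<open>Omega M\<close> classifies sub-\<open>M\<close>-sets.\<close>

lemma (in right_mset) Omega_classifies:
  assumes A: "sub_mset M X A"
  shows "(\<lambda>x. {m \<in> carrier M. ract X x m \<in> A}) \<in> mset_hom M X (Omega M)"
    and "{x \<in> carrier X. {m \<in> carrier M. ract X x m \<in> A} = carrier M} = A"
    and "\<lbrakk>\<chi> \<in> mset_hom M X (Omega M); {x \<in> carrier X. \<chi> x = carrier M} = A; x \<in> carrier X\<rbrakk>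
         \<Longrightarrow> \<chi> x = {m \<in> carrier M. ract X x m \<in> A}"
proof -
  show "(\<lambda>x. {m \<in> carrier M. ract X x m \<in> A}) \<in> mset_hom M X (Omega M)"
    using A by (auto simp: mset_hom_def Omega_def right_ideal_def sub_mset_def ract_mult)
  show "{x \<in> carrier X. {m \<in> carrier M. ract X x m \<in> A} = carrier M} = A"
  proof (intro equalityI subsetI)
    fix x assume "x \<in> {x \<in> carrier X. {m \<in> carrier M. ract X x m \<in> A} = carrier M}"
    then have "x \<in> carrier X" "ract X x \<one>\<^bsub>M\<^esub> \<in> A" by auto
    then show "x \<in> A" by (simp add: ract_one)
  qed (use A in \<open>auto simp: sub_mset_def\<close>)
  assume hom: "\<chi> \<in> mset_hom M X (Omega M)" and top: "{x \<in> carrier X. \<chi> x = carrier M} = A"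
    and x: "x \<in> carrier X"
  have I: "right_ideal M (\<chi> x)" using hom x by (auto simp: mset_hom_def Omega_def)
  have "m \<in> \<chi> x \<longleftrightarrow> ract X x m \<in> A" if m: "m \<in> carrier M" for m
  proof -
    have "ract X x m \<in> A \<longleftrightarrow> \<chi> (ract X x m) = carrier M"
      using top ract_closed[OF x m] by auto
    also have "\<chi> (ract X x m) = {n \<in> carrier M. m \<otimes> n \<in> \<chi> x}"
      using hom x m by (auto simp: mset_hom_def Omega_def)
    also have "\<dots> = carrier M \<longleftrightarrow> m \<in> \<chi> x"
    proof
      assume "{n \<in> carrier M. m \<otimes> n \<in> \<chi> x} = carrier M"
      then have "m \<otimes> \<one> \<in> \<chi> x" using one_closed by blast
      then show "m \<in> \<chi> x" using m by simp
    qed (use I in \<open>auto simp: right_ideal_def\<close>)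
    finally show ?thesis by simp
  qed
  then show "\<chi> x = {m \<in> carrier M. ract X x m \<in> A}" using I by (auto simp: right_ideal_def)
qed

lemma (in monoid) right_ideal_Omega_imp:
  assumes "right_ideal G I" and "right_ideal G J"
  shows "right_ideal G (Omega_imp G I J)"
  using assms by (auto simp: Omega_imp_def right_ideal_def m_assoc)

lemma (in monoid) Omega_imp_adjoint:
  assumes "right_ideal G I" and "right_ideal G J" and "right_ideal G K"
  shows "K \<subseteq> Omega_imp G I J \<longleftrightarrow> K \<inter> I \<subseteq> J"
proof
  assume K: "K \<subseteq> Omega_imp G I J"
  show "K \<inter> I \<subseteq> J"
  proof
    fix m assume m: "m \<in> K \<inter> I"
    then have "m \<in> carrier G" using assms by (auto simp: right_ideal_def)
    moreover from m K have "m \<otimes> \<one> \<in> I \<longrightarrow> m \<otimes> \<one> \<in> J" by (auto simp: Omega_imp_def)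
    ultimately show "m \<in> J" using m by simp
  qed
qed (use assms in \<open>auto simp: Omega_imp_def right_ideal_def\<close>)

lemma (in monoid) Omega_operations_equivariant:
  assumes "m \<in> carrier G"
  shows "ract (Omega G) (Omega_imp G I J) m = Omega_imp G (ract (Omega G) I m) (ract (Omega G) J m)"
    and "ract (Omega G) (I \<inter> J) m = ract (Omega G) I m \<inter> ract (Omega G) J m"
    and "ract (Omega G) (I \<union> J) m = ract (Omega G) I m \<union> ract (Omega G) J m"
    and "ract (Omega G) {} m = {}"
    and "ract (Omega G) (carrier G) m = carrier G"
  using assms by (auto simp: Omega_imp_def Omega_def m_assoc)

text \<open>The external description of de Morgan toposes: \<open>sub_neg M X A\<close> is the pseudocomplement of \<open>A\<close>
  in the Heyting algebra of sub-\<open>M\<close>-sets of \<open>X\<close>.\<close>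

definition sub_neg :: "('m, 'k) monoid_scheme \<Rightarrow> ('a, 'm) right_act \<Rightarrow> 'a set \<Rightarrow> 'a set" where
  "sub_neg M X A = \<Union>{K. sub_mset M X K \<and> K \<inter> A = {}}"

lemma (in right_mset) sub_neg_eq:
  assumes "sub_mset M X A"
  shows "sub_neg M X A = {x \<in> carrier X. \<forall>m\<in>carrier M. ract X x m \<notin> A}" (is "_ = ?N")
proof (intro equalityI subsetI)
  fix x assume "x \<in> sub_neg M X A"
  then show "x \<in> ?N" by (fastforce simp: sub_neg_def sub_mset_def)
next
  fix x assume x: "x \<in> ?N"
  have "sub_mset M X ?N"
    by (auto simp: sub_mset_def ract_closed ract_mult[symmetric])
  moreover have "?N \<inter> A = {}"
    by (auto dest: bspec[OF _ one_closed] simp: ract_one)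
  ultimately show "x \<in> sub_neg M X A" using x unfolding sub_neg_def by blast
qed

lemma (in right_mset) sub_mset_sub_neg: "sub_mset M X (sub_neg M X A)"
  by (auto simp: sub_neg_def sub_mset_def)

lemma de_Morgan_topos_iff:
  fixes M :: "('m, 'k) monoid_scheme" and \<iota> :: "'m \<Rightarrow> 'u"
  assumes M: "monoid M" and \<iota>: "inj_on \<iota> (carrier M)"
  shows "de_Morgan_topos M \<longleftrightarrow>
    (\<forall>(X :: ('u, 'm) right_act) A. right_mset M X \<and> sub_mset M X A \<longrightarrow>
       sub_neg M X A \<union> sub_neg M X (sub_neg M X A) = carrier X)" (is "_ \<longleftrightarrow> ?R")
proof
  assume dM: "de_Morgan_topos M"
  show ?R
  proof (intro allI impI, elim conjE)
    fix X :: "('u, 'm) right_act" and A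
    assume X: "right_mset M X" and A: "sub_mset M X A"
    interpret right_mset M X by (rule X)
    note N = sub_neg_eq[OF A] and NN = sub_neg_eq[OF sub_mset_sub_neg, of A]
    have "x \<in> sub_neg M X A \<union> sub_neg M X (sub_neg M X A)" if x: "x \<in> carrier X" for x
    proof -
      let ?I = "{m \<in> carrier M. ract X x m \<in> A}"
      have "?I \<in> carrier (Omega M)"
        using A x by (auto simp: Omega_def right_ideal_def sub_mset_def ract_mult)
      with dM have "Omega_imp M ?I {} \<union> Omega_imp M (Omega_imp M ?I {}) {} = carrier M"
        unfolding de_Morgan_topos_def by blast
      then have "\<one>\<^bsub>M\<^esub> \<in> Omega_imp M ?I {} \<or> \<one>\<^bsub>M\<^esub> \<in> Omega_imp M (Omega_imp M ?I {}) {}"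
        using one_closed by blast
      then show ?thesis
      proof
        assume "\<one>\<^bsub>M\<^esub> \<in> Omega_imp M ?I {}"
        then have "x \<in> sub_neg M X A" using x unfolding N by (auto simp: Omega_imp_def)
        then show ?thesis by blast
      next
        assume "\<one>\<^bsub>M\<^esub> \<in> Omega_imp M (Omega_imp M ?I {}) {}"
        then have *: "\<exists>k\<in>carrier M. ract X x (n \<otimes>\<^bsub>M\<^esub> k) \<in> A" if "n \<in> carrier M" for n
          using that by (auto simp: Omega_imp_def)
        have "ract X x n \<notin> sub_neg M X A" if n: "n \<in> carrier M" for n
        proof -
          from *[OF n] obtain k where k: "k \<in> carrier M" "ract X x (n \<otimes>\<^bsub>M\<^esub> k) \<in> A" ..
          then have "ract X (ract X x n) k \<in> A" using x n by (simp add: ract_mult)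
          with k show ?thesis unfolding N by blast
        qed
        then have "x \<in> sub_neg M X (sub_neg M X A)" using x unfolding NN by blast
        then show ?thesis by blast
      qed
    qed
    then show "sub_neg M X A \<union> sub_neg M X (sub_neg M X A) = carrier X"
      using sub_mset_sub_neg[of A] sub_mset_sub_neg[of "sub_neg M X A"]
      unfolding sub_mset_def by blast
  qed
next
  assume R: ?R
  interpret monoid M by (rule M)
  let ?Z = "\<lparr>carrier = \<iota> ` carrier M, ract = (\<lambda>u m. \<iota> (inv_into (carrier M) \<iota> u \<otimes>\<^bsub>M\<^esub> m))\<rparr>"
  interpret Z: right_mset M ?Z by (rule right_mset_transport[OF \<iota>])
  show "de_Morgan_topos M"
    unfolding de_Morgan_topos_def
  proof
    fix I assume "I \<in> carrier (Omega M)"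
    then have I: "right_ideal M I" by (simp add: Omega_def)
    have sub: "sub_mset M ?Z (\<iota> ` J)" if "right_ideal M J" for J
      using that \<iota> by (auto simp: sub_mset_def right_ideal_def subset_iff)
    have neg: "sub_neg M ?Z (\<iota> ` J) = \<iota> ` Omega_imp M J {}" if J: "right_ideal M J" for J
    proof -
      have mem: "\<iota> a \<in> \<iota> ` J \<longleftrightarrow> a \<in> J" if "a \<in> carrier M" for a
        using that J \<iota> by (auto simp: right_ideal_def inj_on_image_mem_iff)
      show ?thesis
        unfolding Z.sub_neg_eq[OF sub[OF J]]
      proof (intro equalityI subsetI)
        fix u assume u: "u \<in> {x \<in> carrier ?Z. \<forall>m\<in>carrier M. ract ?Z x m \<notin> \<iota> ` J}"
        then obtain a where a: "a \<in> carrier M" "u = \<iota> a" by auto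
        have "a \<otimes>\<^bsub>M\<^esub> m \<notin> J" if "m \<in> carrier M" for m
          using u that a \<iota> by auto
        with a show "u \<in> \<iota> ` Omega_imp M J {}" by (auto simp: Omega_imp_def)
      next
        fix u assume "u \<in> \<iota> ` Omega_imp M J {}"
        then obtain a where a: "a \<in> carrier M" "u = \<iota> a" "\<forall>m\<in>carrier M. a \<otimes>\<^bsub>M\<^esub> m \<notin> J"
          by (auto simp: Omega_imp_def)
        have "ract ?Z u m \<notin> \<iota> ` J" if "m \<in> carrier M" for m
          using a that \<iota> mem[of "a \<otimes>\<^bsub>M\<^esub> m"] by simp
        with a show "u \<in> {x \<in> carrier ?Z. \<forall>m\<in>carrier M. ract ?Z x m \<notin> \<iota> ` J}" by simp
      qed
    qed
    have E: "right_ideal M {}" by (simp add: right_ideal_def)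
    let ?N = "Omega_imp M I {}"
    have N: "right_ideal M ?N" by (rule right_ideal_Omega_imp[OF I E])
    have "sub_neg M ?Z (\<iota> ` I) \<union> sub_neg M ?Z (sub_neg M ?Z (\<iota> ` I)) = carrier ?Z"
      using R Z.right_mset_axioms sub[OF I] by blast
    then have "\<iota> ` (?N \<union> Omega_imp M ?N {}) = \<iota> ` carrier M"
      unfolding neg[OF I] neg[OF N] image_Un by simp
    moreover have "?N \<union> Omega_imp M ?N {} \<subseteq> carrier M" by (auto simp: Omega_imp_def)
    ultimately show "?N \<union> Omega_imp M ?N {} = carrier M"
      using inj_on_image_eq_iff[OF \<iota>] by blast
  qed
qed

end

theory Submission
  imports Defs
begin

text \<open>Under the Ore condition two elements \<open>x\<close>, \<open>y\<close> of a right \<open>M\<close>-set lie in the same component iff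
  \<open>xm = yn\<close> for some \<open>m\<close>, \<open>n\<close>, and every other condition follows from this description.
  Conversely, if \<open>m\<^sub>1M\<close> and \<open>m\<^sub>2M\<close> are disjoint, then the connected regular \<open>M\<close>-set has the
  disconnected sub-\<open>M\<close>-set \<open>m\<^sub>1M \<union> m\<^sub>2M\<close>, collapsing each of the two ideals gives a connected
  \<open>M\<close>-set with two fixed points, and \<open>m\<^sub>1M\<close> as an element of \<open>\<Omega>\<close> is moved to \<open>M\<close> by \<open>m\<^sub>1\<close> and
  to \<open>\<emptyset>\<close> by \<open>m\<^sub>2\<close>.\<close>

section \<open>Generated equivalence relations and maps between quotients\<close>

lemma equiv_generated_equiv: "equiv A (generated_equiv A r)"
  by (auto simp: equiv_def generated_equiv_def refl_on_def sym_def trans_def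
      intro: equivclp_sym equivclp_trans)

lemma generated_equiv_incl: "r \<subseteq> A \<times> A \<Longrightarrow> r \<subseteq> generated_equiv A r"
  by (auto simp: generated_equiv_def)

lemma generated_equiv_least:
  assumes s: "equiv A s" and "r \<subseteq> s"
  shows "generated_equiv A r \<subseteq> s"
proof clarify
  fix x y assume "(x, y) \<in> generated_equiv A r"
  then have x: "x \<in> A" and xy: "equivclp (\<lambda>u v. (u, v) \<in> r) x y"
    by (auto simp: generated_equiv_def)
  from xy show "(x, y) \<in> s"
  proof (induction rule: equivclp_induct)
    case base
    show ?case using s x by (auto simp: equiv_def refl_on_def)
  next
    case (step y z)
    then have "(y, z) \<in> s" using \<open>r \<subseteq> s\<close> s by (auto dest: equivE symD)
    with step.IH show ?case using s by (meson equivE transD)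
  qed
qed

text \<open>Because \<open>f\<close> respects the relations, a class is sent to the class of the
  image of any representative, so injectivity on classes means that \<open>f\<close> reflects the
  relation. This serves both connected components and tensor products.\<close>

lemma inj_on_quotient_map_iff:
  assumes r: "equiv A r" and s: "equiv B s" and f: "f \<in> A \<rightarrow> B"
    and resp: "\<And>x y. (x, y) \<in> r \<Longrightarrow> (f x, f y) \<in> s"
  shows "inj_on (\<lambda>c. s `` (f ` c)) (A // r) \<longleftrightarrow>
    (\<forall>x\<in>A. \<forall>y\<in>A. (f x, f y) \<in> s \<longrightarrow> (x, y) \<in> r)" (is "?L \<longleftrightarrow> ?R")
proof -
  have cl: "s `` (f ` (r `` {x})) = s `` {f x}" if "x \<in> A" for x
  proof -
    have "s `` {f y} = s `` {f x}" if "y \<in> r `` {x}" for y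
      using resp that by (auto intro!: equiv_class_eq[OF s, symmetric])
    moreover have "x \<in> r `` {x}" using equiv_class_self[OF r that] .
    ultimately show ?thesis by blast
  qed
  show ?thesis
  proof
    assume L: ?L
    show ?R
    proof (intro ballI impI)
      fix x y assume x: "x \<in> A" and y: "y \<in> A" and "(f x, f y) \<in> s"
      then have "s `` (f ` (r `` {x})) = s `` (f ` (r `` {y}))"
        using cl equiv_class_eq[OF s] by metis
      then have "r `` {x} = r `` {y}"
        using inj_onD[OF L] quotientI[OF x] quotientI[OF y] by metis
      then show "(x, y) \<in> r" using eq_equiv_class[OF _ r y] by blast
    qed
  next
    assume R: ?R
    show ?L
    proof (rule inj_onI)
      fix c d assume "c \<in> A // r" "d \<in> A // r" and eq: "s `` (f ` c) = s `` (f ` d)"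
      then obtain x y where x: "x \<in> A" "c = r `` {x}" and y: "y \<in> A" "d = r `` {y}"
        by (auto elim!: quotientE)
      then have "s `` {f x} = s `` {f y}" using eq cl by metis
      then have "(f x, f y) \<in> s" using f y eq_equiv_class[OF _ s] by blast
      then show "c = d" using R x y equiv_class_eq[OF r] by metis
    qed
  qed
qed

section \<open>The connectedness relation and its functoriality\<close>

lemma equiv_conn_rel: "equiv (carrier X) (conn_rel M X)"
  unfolding conn_rel_def by (rule equiv_generated_equiv)

lemma conn_rel_carrier: "(x, y) \<in> conn_rel M X \<Longrightarrow> x \<in> carrier X \<and> y \<in> carrier X"
  by (auto simp: conn_rel_def generated_equiv_def)

lemma conn_rel_eq_TimesI:
  assumes "\<And>x y. x \<in> carrier X \<Longrightarrow> y \<in> carrier X \<Longrightarrow> (x, y) \<in> conn_rel M X"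
  shows "conn_rel M X = carrier X \<times> carrier X"
proof (rule equalityI)
  show "carrier X \<times> carrier X \<subseteq> conn_rel M X" using assms by auto
qed (auto dest: conn_rel_carrier)

lemma conn_rel_sym: "(x, y) \<in> conn_rel M X \<Longrightarrow> (y, x) \<in> conn_rel M X"
  using equiv_conn_rel[of X M] by (meson equivE symD)

lemma conn_rel_trans:
  "(x, y) \<in> conn_rel M X \<Longrightarrow> (y, z) \<in> conn_rel M X \<Longrightarrow> (x, z) \<in> conn_rel M X"
  using equiv_conn_rel[of X M] by (meson equivE transD)

lemma conn_rel_least:
  assumes "equiv (carrier X) s"
    and "\<And>x m. x \<in> carrier X \<Longrightarrow> m \<in> carrier M \<Longrightarrow> (x, ract X x m) \<in> s"
  shows "conn_rel M X \<subseteq> s"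
  unfolding conn_rel_def by (rule generated_equiv_least) (use assms in auto)

lemma (in right_mset) conn_rel_ract:
  "x \<in> carrier X \<Longrightarrow> m \<in> carrier M \<Longrightarrow> (x, ract X x m) \<in> conn_rel M X"
  unfolding conn_rel_def by (rule subsetD[OF generated_equiv_incl]) (auto simp: ract_closed)

text \<open>The kernel of \<open>g\<close> on the carrier is an equivalence relation containing the
  generating pairs. Choosing a suitable \<open>g\<close> is the means of showing that two elements
  are not connected.\<close>

lemma (in right_mset) conn_rel_invariant:
  assumes "(x, y) \<in> conn_rel M X"
    and "\<And>x m. x \<in> carrier X \<Longrightarrow> m \<in> carrier M \<Longrightarrow> g (ract X x m) = g x"
  shows "g x = g y"
proof -
  have "conn_rel M X \<subseteq> {(x, y). x \<in> carrier X \<and> y \<in> carrier X \<and> g x = g y}"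
  proof (rule conn_rel_least)
    show "equiv (carrier X) {(x, y). x \<in> carrier X \<and> y \<in> carrier X \<and> g x = g y}"
      by (auto simp: equiv_def refl_on_def sym_def trans_def)
  qed (simp add: assms(2) ract_closed)
  with assms(1) show ?thesis by blast
qed

lemma conn_rel_hom:
  assumes "right_mset M X" and Y: "right_mset M Y" and f: "f \<in> mset_hom M X Y"
    and "(x, y) \<in> conn_rel M X"
  shows "(f x, f y) \<in> conn_rel M Y"
proof -
  interpret X: right_mset M X by fact
  interpret Y: right_mset M Y by fact
  have fc: "f x \<in> carrier Y" if "x \<in> carrier X" for x using f that by (auto simp: mset_hom_def)
  \<comment> \<open>The invariant is the map sending a point of \<open>X\<close> to the component of
    its image in \<open>Y\<close>.\<close>
  have "conn_rel M Y `` {f x} = conn_rel M Y `` {f y}"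
  proof (rule X.conn_rel_invariant[OF \<open>(x, y) \<in> _\<close>])
    fix x m assume "x \<in> carrier X" "m \<in> carrier M"
    then have "(f x, f (ract X x m)) \<in> conn_rel M Y"
      using f Y.conn_rel_ract fc by (auto simp: mset_hom_def)
    then show "conn_rel M Y `` {f (ract X x m)} = conn_rel M Y `` {f x}"
      using equiv_class_eq[OF equiv_conn_rel] by metis
  qed
  then show ?thesis
    using fc conn_rel_carrier[OF \<open>(x, y) \<in> _\<close>] eq_equiv_class[OF _ equiv_conn_rel] by metis
qed

lemma inj_on_components_map_iff:
  assumes "right_mset M X" and "right_mset M Y" and f: "f \<in> mset_hom M X Y"
  shows "inj_on (components_map M Y f) (components M X) \<longleftrightarrow>
    (\<forall>x\<in>carrier X. \<forall>y\<in>carrier X. (f x, f y) \<in> conn_rel M Y \<longrightarrow> (x, y) \<in> conn_rel M X)"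
  unfolding components_map_def[abs_def] components_def
  by (rule inj_on_quotient_map_iff[OF equiv_conn_rel equiv_conn_rel _ conn_rel_hom[OF assms]])
    (use f in \<open>auto simp: mset_hom_def\<close>)

section \<open>Connected components as the tensor product with the terminal left M-set\<close>

text \<open>With a one-point second factor the generators of \<open>tensor_rel\<close> are those of
  \<open>conn_rel\<close> reversed, and an equivalence relation does not see the direction. Each
  inclusion follows from minimality of the smaller relation.\<close>

lemma tensor_rel_terminal_left:
  fixes X :: "('a, 'm) right_act"
  assumes "right_mset M X"
  shows "((x, u), (y, v)) \<in> tensor_rel M X terminal_left \<longleftrightarrow> (x, y) \<in> conn_rel M X"
proof -
  interpret right_mset M X by fact
  let ?C = "carrier X \<times> carrier (terminal_left :: (unit, 'm) left_act)"
  let ?s = "{((x, u :: unit), (y, v :: unit)). (x, y) \<in> conn_rel M X}"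
  have "equiv ?C ?s"
  proof (rule equivI)
    show "?s \<subseteq> ?C \<times> ?C" by (auto dest: conn_rel_carrier simp: terminal_left_def)
    show "refl_on ?C ?s"
      using equiv_conn_rel[of X M] by (auto simp: equiv_def refl_on_def)
    show "sym ?s" by (rule symI) (auto intro: conn_rel_sym)
    show "trans ?s" by (rule transI) (auto intro: conn_rel_trans)
  qed
  then have 1: "tensor_rel M X terminal_left \<subseteq> ?s"
    unfolding tensor_rel_def
    by (rule generated_equiv_least) (auto intro: conn_rel_sym conn_rel_ract)
  have T: "equiv ?C (tensor_rel M X terminal_left)"
    unfolding tensor_rel_def by (rule equiv_generated_equiv)
  have "((ract X x m, ()), (x, ())) \<in> tensor_rel M X terminal_left"
    if "x \<in> carrier X" "m \<in> carrier M" for x m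
    unfolding tensor_rel_def
    by (rule subsetD[OF generated_equiv_incl])
      (use that ract_closed in \<open>auto simp: terminal_left_def\<close>)
  then have step: "((x, ()), (ract X x m, ())) \<in> tensor_rel M X terminal_left"
    if "x \<in> carrier X" "m \<in> carrier M" for x m
    using that T by (meson equivE symD)
  have "conn_rel M X \<subseteq> {(x, y). ((x, ()), (y, ())) \<in> tensor_rel M X terminal_left}" (is "_ \<subseteq> ?t")
  proof (rule conn_rel_least)
    show "equiv (carrier X) ?t"
    proof (rule equivI)
      show "?t \<subseteq> carrier X \<times> carrier X"
        using T by (auto simp: equiv_def)
      show "refl_on (carrier X) ?t"
        using T by (auto simp: equiv_def refl_on_def terminal_left_def)
      show "sym ?t" using T by (auto simp: equiv_def intro!: symI dest: symD)
      show "trans ?t" using T by (auto simp: equiv_def intro!: transI dest: transD)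
    qed
  qed (use step in simp)
  with 1 show ?thesis by auto
qed

lemma inj_on_tensor_map_terminal_left_iff:
  fixes X :: "('a, 'm) right_act"
  assumes X: "right_mset M X" and Y: "right_mset M Y" and f: "f \<in> mset_hom M X Y"
  shows "inj_on (tensor_map M Y terminal_left f) (tensor M X terminal_left) \<longleftrightarrow>
    inj_on (components_map M Y f) (components M X)"
proof -
  have "inj_on (tensor_map M Y terminal_left f) (tensor M X terminal_left) \<longleftrightarrow>
    (\<forall>p\<in>carrier X \<times> carrier (terminal_left :: (unit, 'm) left_act).
     \<forall>q\<in>carrier X \<times> carrier (terminal_left :: (unit, 'm) left_act).
       (map_prod f id p, map_prod f id q) \<in> tensor_rel M Y terminal_left \<longrightarrow>
       (p, q) \<in> tensor_rel M X terminal_left)"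
    unfolding tensor_map_def[abs_def] tensor_def
  proof (rule inj_on_quotient_map_iff[where
        B = "carrier Y \<times> carrier (terminal_left :: (unit, 'm) left_act)"])
    fix p q assume "(p, q) \<in> tensor_rel M X terminal_left"
    then show "(map_prod f id p, map_prod f id q) \<in> tensor_rel M Y terminal_left"
      using conn_rel_hom[OF X Y f]
      by (cases p; cases q) (simp add: tensor_rel_terminal_left[OF X] tensor_rel_terminal_left[OF Y])
  qed (use f in \<open>auto simp: tensor_rel_def equiv_generated_equiv mset_hom_def\<close>)
  also have "\<dots> \<longleftrightarrow> inj_on (components_map M Y f) (components M X)"
    unfolding inj_on_components_map_iff[OF assms]
    by (simp add: tensor_rel_terminal_left[OF X] tensor_rel_terminal_left[OF Y])
      (simp add: terminal_left_def)
  finally show ?thesis .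
qed

lemma mono_flat_terminal_left_iff:
  assumes "monoid M"
  shows "mono_flat TYPE('u) M terminal_left \<longleftrightarrow> components_preserves_monos TYPE('u) M"
proof -
  have "left_mset M terminal_left"
    using assms by (auto simp: left_mset_def left_mset_axioms_def terminal_left_def)
  moreover have "f \<in> mset_hom M X Y" if "mset_mono M X Y f"
    for X Y :: "('u, 'a) right_act" and f
    using that by (simp add: mset_mono_def)
  ultimately show ?thesis
    unfolding mono_flat_def components_preserves_monos_def
    using inj_on_tensor_map_terminal_left_iff by blast
qed

section \<open>Sub-M-sets and indecomposability\<close>

lemma (in right_mset) right_mset_restrict: "sub_mset M X A \<Longrightarrow> right_mset M (restrict_mset X A)"
  by unfold_locales (auto simp: sub_mset_def restrict_mset_def ract_one ract_mult subset_iff)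

text \<open>A component and its complement always form a coproduct decomposition. Conversely, in a
  coproduct the action never leaves a summand, so connected elements lie in the same one.\<close>

lemma (in right_mset) indecomposable_iff_conn_rel:
  "indecomposable M X \<longleftrightarrow> carrier X \<noteq> {} \<and> conn_rel M X = carrier X \<times> carrier X"
proof
  assume ind: "indecomposable M X"
  have "(a, b) \<in> conn_rel M X" if a: "a \<in> carrier X" and b: "b \<in> carrier X" for a b
  proof -
    define A where "A = conn_rel M X `` {a}"
    let ?X1 = "restrict_mset X A" and ?X2 = "restrict_mset X (carrier X - A)"
    have A: "A \<subseteq> carrier X" using conn_rel_carrier by (fastforce simp: A_def)
    \<comment> \<open>The equivalence, rather than one implication, makes both \<open>A\<close> and
      its complement closed under the action.\<close>
    have act: "ract X x m \<in> A \<longleftrightarrow> x \<in> A" if "x \<in> carrier X" "m \<in> carrier M" for x m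
      unfolding A_def using conn_rel_ract[OF that] by (auto intro: conn_rel_trans conn_rel_sym)
    have "right_mset M ?X1" "right_mset M ?X2"
      by (rule right_mset_restrict; use A act ract_closed in \<open>auto simp: sub_mset_def\<close>)+
    moreover have "mset_isomorphic M X (mset_coprod ?X1 ?X2)"
      unfolding mset_isomorphic_def
    proof
      let ?f = "\<lambda>x. if x \<in> A then Inl x else Inr x"
      show "?f \<in> mset_hom M X (mset_coprod ?X1 ?X2)"
        by (auto simp: mset_hom_def mset_coprod_def restrict_mset_def act)
      show "bij_betw ?f (carrier X) (carrier (mset_coprod ?X1 ?X2))"
        using A by (auto simp: bij_betw_def inj_on_def mset_coprod_def restrict_mset_def
            image_iff split: if_splits)
    qed
    ultimately have "carrier ?X1 = {} \<or> carrier ?X2 = {}"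
      using ind unfolding indecomposable_def by blast
    then have "A = {} \<or> carrier X - A = {}" by (simp add: restrict_mset_def)
    moreover have "a \<in> A"
      unfolding A_def using equiv_class_self[OF equiv_conn_rel a] .
    ultimately have "b \<in> A" using b by blast
    then show ?thesis by (simp add: A_def)
  qed
  then have "conn_rel M X = carrier X \<times> carrier X" by (rule conn_rel_eq_TimesI)
  with ind show "carrier X \<noteq> {} \<and> conn_rel M X = carrier X \<times> carrier X"
    by (simp add: indecomposable_def)
next
  assume conn: "carrier X \<noteq> {} \<and> conn_rel M X = carrier X \<times> carrier X"
  have "carrier X1 = {} \<or> carrier X2 = {}"
    if iso: "mset_isomorphic M X (mset_coprod X1 X2)" for X1 X2 :: "('a, 'm) right_act"
  proof (rule ccontr)
    assume "\<not> ?thesis"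
    then obtain a b where "Inl a \<in> carrier (mset_coprod X1 X2)" "Inr b \<in> carrier (mset_coprod X1 X2)"
      by (auto simp: mset_coprod_def)
    moreover from iso obtain f where f: "f \<in> mset_hom M X (mset_coprod X1 X2)"
      and "f ` carrier X = carrier (mset_coprod X1 X2)"
      by (auto simp: mset_isomorphic_def bij_betw_def)
    ultimately obtain x y where xy: "x \<in> carrier X" "y \<in> carrier X" "f x = Inl a" "f y = Inr b"
      by (metis imageE)
    \<comment> \<open>The summand containing \<open>f x\<close> is an invariant of the action, hence
      constant on the connected \<open>X\<close>.\<close>
    have "isl (f x) = isl (f y)"
    proof (rule conn_rel_invariant)
      fix x m assume "x \<in> carrier X" "m \<in> carrier M"
      with f have "f (ract X x m) = ract (mset_coprod X1 X2) (f x) m" by (simp add: mset_hom_def)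
      then show "isl (f (ract X x m)) = isl (f x)" by (simp add: mset_coprod_def split: sum.split)
    qed (use conn xy in simp)
    with xy show False by simp
  qed
  with conn show "indecomposable M X" by (simp add: indecomposable_def)
qed

text \<open>If \<open>A\<close> and \<open>B\<close> were disjoint, membership in \<open>A\<close>
  would be an invariant of the action on the union, and it separates \<open>a\<close> from
  \<open>b\<close>.\<close>

lemma (in right_mset) restrict_Un_conn_relD:
  assumes A: "sub_mset M X A" and B: "sub_mset M X B" and ab: "a \<in> A" "b \<in> B"
    and conn: "(a, b) \<in> conn_rel M (restrict_mset X (A \<union> B))"
  shows "A \<inter> B \<noteq> {}"
proof
  assume disj: "A \<inter> B = {}"
  interpret R: right_mset M "restrict_mset X (A \<union> B)"
    by (rule right_mset_restrict) (use A B in \<open>auto simp: sub_mset_def\<close>)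
  have "(a \<in> A) = (b \<in> A)"
    by (rule R.conn_rel_invariant[OF conn])
      (use A B disj in \<open>auto simp: restrict_mset_def sub_mset_def\<close>)
  with ab disj show False by blast
qed

section \<open>Consequences of the Ore condition\<close>

lemma right_OreE:
  assumes "right_Ore M" "m\<^sub>1 \<in> carrier M" "m\<^sub>2 \<in> carrier M"
  obtains m n where "m \<in> carrier M" "n \<in> carrier M" "m\<^sub>1 \<otimes>\<^bsub>M\<^esub> m = m\<^sub>2 \<otimes>\<^bsub>M\<^esub> n"
proof -
  have "\<exists>m\<in>carrier M. \<exists>n\<in>carrier M. m\<^sub>1 \<otimes>\<^bsub>M\<^esub> m = m\<^sub>2 \<otimes>\<^bsub>M\<^esub> n"
    using assms(1-3) by (simp add: right_Ore_def)
  then show thesis by (elim bexE) (rule that)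
qed

text \<open>Having a common translate is reflexive and symmetric in any M-set and contains the
  generating pairs. The Ore condition supplies transitivity, so this relation is already the
  generated equivalence.\<close>

lemma (in right_mset) conn_rel_iff_Ore:
  assumes ore: "right_Ore M"
  shows "(x, y) \<in> conn_rel M X \<longleftrightarrow> x \<in> carrier X \<and> y \<in> carrier X \<and>
    (\<exists>m\<in>carrier M. \<exists>n\<in>carrier M. ract X x m = ract X y n)" (is "_ \<longleftrightarrow> ?R x y")
proof
  have RI: "?R x y" if "x \<in> carrier X" "y \<in> carrier X" "m \<in> carrier M" "n \<in> carrier M"
    "ract X x m = ract X y n" for x y m n
    using that by blast
  have "conn_rel M X \<subseteq> {(x, y). ?R x y}"
  proof (rule conn_rel_least)
    show "equiv (carrier X) {(x, y). ?R x y}"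
    proof (rule equivI)
      show "trans {(x, y). ?R x y}"
      proof (rule transI)
        fix x y z assume "(x, y) \<in> {(x, y). ?R x y}" "(y, z) \<in> {(x, y). ?R x y}"
        then obtain m n k l where c: "x \<in> carrier X" "y \<in> carrier X" "z \<in> carrier X"
          "m \<in> carrier M" "n \<in> carrier M" "k \<in> carrier M" "l \<in> carrier M"
          and eq: "ract X x m = ract X y n" "ract X y k = ract X z l"
          by blast
        \<comment> \<open>The two translates \<open>yn\<close> and \<open>yk\<close> of the middle
          point are brought together by Ore, giving \<open>xmp = ynp = ykq = zlq\<close>.\<close>
        obtain p q where pq: "p \<in> carrier M" "q \<in> carrier M" "n \<otimes> p = k \<otimes> q"
          by (rule right_OreE[OF ore c(5,6)])
        have "ract X x (m \<otimes> p) = ract X y (n \<otimes> p)" using c pq(1) eq(1) by (simp add: ract_mult)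
        also have "\<dots> = ract X y (k \<otimes> q)" using pq(3) by simp
        also have "\<dots> = ract X z (l \<otimes> q)" using c pq(2) eq(2) by (simp add: ract_mult)
        finally have "?R x z" by (rule RI[rotated -1]) (use c pq in simp_all)
        then show "(x, z) \<in> {(x, y). ?R x y}" by simp
      qed
    next
      show "sym {(x, y). ?R x y}"
      proof (rule symI)
        fix x y assume "(x, y) \<in> {(x, y). ?R x y}"
        then obtain m n where "x \<in> carrier X" "y \<in> carrier X" "m \<in> carrier M" "n \<in> carrier M"
          "ract X y n = ract X x m"
          by force
        then have "?R y x" by (intro RI)
        then show "(y, x) \<in> {(x, y). ?R x y}" by simp
      qed
      show "refl_on (carrier X) {(x, y). ?R x y}"
      proof (rule refl_onI)
        fix x assume "x \<in> carrier X"
        then have "?R x x" using RI[OF _ _ one_closed one_closed refl] by simp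
        then show "(x, x) \<in> {(x, y). ?R x y}" by simp
      qed
    qed auto
    fix x m assume "x \<in> carrier X" "m \<in> carrier M"
    \<comment> \<open>A generating pair has the common translate \<open>xm = (xm)1\<close>.\<close>
    then have "?R x (ract X x m)" by (intro RI[of _ _ m \<one>]) (simp_all add: ract_closed ract_one)
    then show "(x, ract X x m) \<in> {(x, y). ?R x y}" by simp
  qed
  then show "?R x y" if "(x, y) \<in> conn_rel M X" using that by auto
next
  assume "?R x y"
  then obtain m n where xy: "x \<in> carrier X" "y \<in> carrier X" and mn: "m \<in> carrier M" "n \<in> carrier M"
    and eq: "ract X x m = ract X y n"
    by blast
  have "(x, ract X y n) \<in> conn_rel M X" using conn_rel_ract[OF xy(1) mn(1)] unfolding eq .
  then show "(x, y) \<in> conn_rel M X"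
    using conn_rel_sym[OF conn_rel_ract[OF xy(2) mn(2)]] by (rule conn_rel_trans)
qed

text \<open>A common translate of \<open>f x\<close> and \<open>f y\<close> has the form
  \<open>f (xm) = f (yn)\<close>, and injectivity of \<open>f\<close> lifts it to a common translate
  of \<open>x\<close> and \<open>y\<close>.\<close>

lemma Ore_imp_components_preserves_monos:
  fixes M :: "('m, 'k) monoid_scheme" and \<iota> :: "'m \<Rightarrow> 'u"
  assumes ore: "right_Ore M" and \<iota>: "inj_on \<iota> (carrier M)"
  shows "components_preserves_monos TYPE('u) M"
  unfolding components_preserves_monos_def
proof (intro allI impI, elim conjE)
  fix X Y :: "('u, 'm) right_act" and f
  assume X: "right_mset M X" and Y: "right_mset M Y" and "mset_mono M X Y f"
  then have f: "f \<in> mset_hom M X Y" "inj_on f (carrier X)" by (simp_all add: mset_mono_iff[OF X \<iota>])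
  interpret X: right_mset M X by (rule X)
  interpret Y: right_mset M Y by (rule Y)
  show "inj_on (components_map M Y f) (components M X)"
    unfolding inj_on_components_map_iff[OF X Y f(1)]
  proof (intro ballI impI)
    fix x y assume xy: "x \<in> carrier X" "y \<in> carrier X" "(f x, f y) \<in> conn_rel M Y"
    then obtain m n where mn: "m \<in> carrier M" "n \<in> carrier M" "ract Y (f x) m = ract Y (f y) n"
      unfolding Y.conn_rel_iff_Ore[OF ore] by blast
    then have "f (ract X x m) = f (ract X y n)" using f(1) xy by (simp add: mset_hom_def)
    then have "ract X x m = ract X y n"
      using inj_onD[OF f(2)] X.ract_closed xy mn by metis
    with xy mn show "(x, y) \<in> conn_rel M X" unfolding X.conn_rel_iff_Ore[OF ore] by blast
  qed
qed

lemma (in right_mset) Ore_imp_sub_msets_meet: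
  assumes ore: "right_Ore M" and ind: "indecomposable M X"
    and A: "sub_mset M X A" "A \<noteq> {}" and B: "sub_mset M X B" "B \<noteq> {}"
  shows "A \<inter> B \<noteq> {}"
proof -
  from A B obtain a b where ab: "a \<in> A" "b \<in> B" by blast
  then have "(a, b) \<in> conn_rel M X"
    using ind A B by (auto simp: indecomposable_iff_conn_rel sub_mset_def)
  then obtain m n where "m \<in> carrier M" "n \<in> carrier M" "ract X a m = ract X b n"
    unfolding conn_rel_iff_Ore[OF ore] by blast
  with ab A B show ?thesis unfolding sub_mset_def by (metis IntI empty_iff)
qed

text \<open>A zigzag between two points of \<open>A\<close> could leave \<open>A\<close>, but their
  common translate lies in \<open>A\<close>; hence connectedness in \<open>X\<close> restricts to
  connectedness in \<open>A\<close>.\<close>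

lemma (in right_mset) Ore_imp_indecomposable_restrict:
  assumes ore: "right_Ore M" and ind: "indecomposable M X"
    and A: "sub_mset M X A" "A \<noteq> {}"
  shows "indecomposable M (restrict_mset X A)"
proof -
  interpret A: right_mset M "restrict_mset X A" by (rule right_mset_restrict) fact
  have "(a, b) \<in> conn_rel M (restrict_mset X A)" if "a \<in> A" "b \<in> A" for a b
  proof -
    have "(a, b) \<in> conn_rel M X"
      using that ind A by (auto simp: indecomposable_iff_conn_rel sub_mset_def)
    then have "\<exists>m\<in>carrier M. \<exists>n\<in>carrier M. ract X a m = ract X b n"
      unfolding conn_rel_iff_Ore[OF ore] by blast
    with that show ?thesis
      unfolding A.conn_rel_iff_Ore[OF ore] by (simp add: restrict_mset_def)
  qed
  with A(2) show ?thesis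
    unfolding A.indecomposable_iff_conn_rel
    by (intro conjI conn_rel_eq_TimesI) (simp_all add: restrict_mset_def)
qed

text \<open>For connected fixed points a common translate gives
  \<open>x = xm = yn = y\<close>.\<close>

lemma (in right_mset) Ore_imp_inj_on_alpha:
  assumes ore: "right_Ore M"
  shows "inj_on (alpha M X) (global_sections M X)"
proof (rule inj_onI)
  fix x y assume x: "x \<in> global_sections M X" and y: "y \<in> global_sections M X"
    and eq: "alpha M X x = alpha M X y"
  have "y \<in> carrier X" using y by (simp add: global_sections_def)
  then have "(x, y) \<in> conn_rel M X"
    by (rule eq_equiv_class[OF eq[unfolded alpha_def] equiv_conn_rel])
  then obtain m n where mn: "m \<in> carrier M" "n \<in> carrier M" "ract X x m = ract X y n"
    unfolding conn_rel_iff_Ore[OF ore] by blast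
  have "x = ract X x m" using x mn(1) by (simp add: global_sections_def)
  also have "\<dots> = y" unfolding mn(3) using y mn(2) by (simp add: global_sections_def)
  finally show "x = y" .
qed

section \<open>The regular M-set and principal right ideals\<close>

text \<open>Right multiplication of \<open>M\<close> on itself is transported along
  \<open>\<iota>\<close>, since the conditions of the theorem range over M-sets with elements in
  \<open>'u\<close>.\<close>

definition regular_mset :: "('m, 'k) monoid_scheme \<Rightarrow> ('m \<Rightarrow> 'u) \<Rightarrow> ('u, 'm) right_act" where
  "regular_mset M \<iota> = \<lparr>carrier = \<iota> ` carrier M,
     ract = (\<lambda>u m. \<iota> (inv_into (carrier M) \<iota> u \<otimes>\<^bsub>M\<^esub> m))\<rparr>"

definition principal_ideal :: "('m, 'k) monoid_scheme \<Rightarrow> 'm \<Rightarrow> 'm set" where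
  "principal_ideal M m = (\<lambda>n. m \<otimes>\<^bsub>M\<^esub> n) ` carrier M"

lemma right_Ore_iff_principal_ideals_meet:
  "right_Ore M \<longleftrightarrow> (\<forall>m\<^sub>1\<in>carrier M. \<forall>m\<^sub>2\<in>carrier M.
     principal_ideal M m\<^sub>1 \<inter> principal_ideal M m\<^sub>2 \<noteq> {})"
  unfolding right_Ore_def principal_ideal_def by blast

lemma carrier_regular_mset: "carrier (regular_mset M \<iota>) = \<iota> ` carrier M"
  by (simp add: regular_mset_def)

lemma ract_regular_mset:
  "inj_on \<iota> (carrier M) \<Longrightarrow> a \<in> carrier M \<Longrightarrow> ract (regular_mset M \<iota>) (\<iota> a) m = \<iota> (a \<otimes>\<^bsub>M\<^esub> m)"
  by (simp add: regular_mset_def)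

context monoid
begin

lemma right_mset_regular: "inj_on \<iota> (carrier G) \<Longrightarrow> right_mset G (regular_mset G \<iota>)"
  unfolding regular_mset_def by (rule right_mset_transport)

lemma right_ideal_principal: "m \<in> carrier G \<Longrightarrow> right_ideal G (principal_ideal G m)"
  by (auto simp: right_ideal_def principal_ideal_def m_assoc)

lemma principal_ideal_self: "m \<in> carrier G \<Longrightarrow> m \<in> principal_ideal G m"
  unfolding principal_ideal_def by (rule image_eqI[OF _ one_closed]) simp

lemma sub_mset_regular:
  assumes "inj_on \<iota> (carrier G)" and "right_ideal G I"
  shows "sub_mset G (regular_mset G \<iota>) (\<iota> ` I)"
  using assms
  by (auto simp: sub_mset_def right_ideal_def carrier_regular_mset ract_regular_mset subset_iff)

text \<open>Every element is a translate of the unit, so the unit is connected to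
  everything.\<close>

lemma conn_rel_regular:
  assumes "inj_on \<iota> (carrier G)" and "a \<in> carrier G" and "b \<in> carrier G"
  shows "(\<iota> a, \<iota> b) \<in> conn_rel G (regular_mset G \<iota>)"
proof -
  interpret R: right_mset G "regular_mset G \<iota>" using assms(1) by (rule right_mset_regular)
  have "(\<iota> \<one>, \<iota> c) \<in> conn_rel G (regular_mset G \<iota>)" if "c \<in> carrier G" for c
    using R.conn_rel_ract[of "\<iota> \<one>" c] that assms(1)
    by (simp add: carrier_regular_mset ract_regular_mset)
  with assms(2,3) show ?thesis by (blast intro: conn_rel_sym conn_rel_trans)
qed

lemma indecomposable_regular:
  assumes "inj_on \<iota> (carrier G)"
  shows "indecomposable G (regular_mset G \<iota>)"
proof -
  interpret R: right_mset G "regular_mset G \<iota>" using assms by (rule right_mset_regular)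
  show ?thesis
    unfolding R.indecomposable_iff_conn_rel
    by (intro conjI conn_rel_eq_TimesI)
      (use conn_rel_regular[OF assms] one_closed in \<open>auto simp: carrier_regular_mset\<close>)
qed

section \<open>Deriving the Ore condition from M-sets built on the regular one\<close>

text \<open>The images of two principal ideals are non-empty sub-M-sets of the regular M-set, and a
  common point pulls back along the injection \<open>\<iota>\<close>. Non-emptiness is phrased with
  points \<open>a\<close> and \<open>b\<close> so that they can be tested for connectedness.\<close>

lemma right_OreI_regular:
  assumes \<iota>: "inj_on \<iota> (carrier G)"
    and meet: "\<And>A B a b. sub_mset G (regular_mset G \<iota>) A \<Longrightarrow> sub_mset G (regular_mset G \<iota>) B \<Longrightarrow>
      a \<in> A \<Longrightarrow> b \<in> B \<Longrightarrow> A \<inter> B \<noteq> {}"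
  shows "right_Ore G"
  unfolding right_Ore_iff_principal_ideals_meet
proof (intro ballI)
  fix p q assume pq: "p \<in> carrier G" "q \<in> carrier G"
  have "\<iota> ` principal_ideal G p \<inter> \<iota> ` principal_ideal G q \<noteq> {}"
    by (rule meet[OF sub_mset_regular[OF \<iota> right_ideal_principal]
          sub_mset_regular[OF \<iota> right_ideal_principal]
          imageI[OF principal_ideal_self] imageI[OF principal_ideal_self]])
      (use pq in simp_all)
  moreover have "principal_ideal G p \<subseteq> carrier G" "principal_ideal G q \<subseteq> carrier G"
    using pq right_ideal_principal by (auto simp: right_ideal_def)
  ultimately show "principal_ideal G p \<inter> principal_ideal G q \<noteq> {}"
    by (metis inj_on_image_Int[OF \<iota>] image_empty)
qed

text \<open>Apply the hypothesis to the inclusion of \<open>A \<union> B\<close> into the regular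
  M-set: \<open>a\<close> and \<open>b\<close> are connected in the latter, hence already in the
  union, which forces \<open>A\<close> and \<open>B\<close> to meet.\<close>

lemma components_preserves_monos_imp_Ore:
  fixes \<iota> :: "'a \<Rightarrow> 'u"
  assumes mono: "components_preserves_monos TYPE('u) G" and \<iota>: "inj_on \<iota> (carrier G)"
  shows "right_Ore G"
proof (rule right_OreI_regular[OF \<iota>])
  let ?Z = "regular_mset G \<iota>"
  interpret Z: right_mset G ?Z using \<iota> by (rule right_mset_regular)
  fix A B a b
  assume A: "sub_mset G ?Z A" and B: "sub_mset G ?Z B" and ab: "a \<in> A" "b \<in> B"
  let ?Y = "restrict_mset ?Z (A \<union> B)"
  have Y: "right_mset G ?Y"
    by (rule Z.right_mset_restrict) (use A B in \<open>auto simp: sub_mset_def\<close>)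
  have hom: "id \<in> mset_hom G ?Y ?Z"
    using A B by (auto simp: mset_hom_def restrict_mset_def sub_mset_def)
  then have "mset_mono G ?Y ?Z id" by (simp add: mset_mono_iff[OF Y \<iota>])
  then have "inj_on (components_map G ?Z id) (components G ?Y)"
    using mono Y Z.right_mset_axioms unfolding components_preserves_monos_def by blast
  moreover have "(a, b) \<in> conn_rel G ?Z"
    using ab A B indecomposable_regular[OF \<iota>]
    by (auto simp: Z.indecomposable_iff_conn_rel sub_mset_def)
  ultimately have "(a, b) \<in> conn_rel G ?Y"
    using ab inj_on_components_map_iff[OF Y Z.right_mset_axioms hom]
    by (simp add: restrict_mset_def)
  then show "A \<inter> B \<noteq> {}" by (rule Z.restrict_Un_conn_relD[OF A B ab])
qed

text \<open>Here the union \<open>A \<union> B\<close> is connected because it is a non-empty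
  sub-M-set of the indecomposable regular M-set.\<close>

lemma indecomposable_restrict_imp_Ore:
  fixes \<iota> :: "'a \<Rightarrow> 'u"
  assumes ind: "\<And>(X :: ('u, 'a) right_act) A. right_mset G X \<Longrightarrow> indecomposable G X \<Longrightarrow>
      sub_mset G X A \<Longrightarrow> A = {} \<or> indecomposable G (restrict_mset X A)"
    and \<iota>: "inj_on \<iota> (carrier G)"
  shows "right_Ore G"
proof (rule right_OreI_regular[OF \<iota>])
  let ?Z = "regular_mset G \<iota>"
  interpret Z: right_mset G ?Z using \<iota> by (rule right_mset_regular)
  fix A B a b
  assume A: "sub_mset G ?Z A" and B: "sub_mset G ?Z B" and ab: "a \<in> A" "b \<in> B"
  let ?Y = "restrict_mset ?Z (A \<union> B)"
  have sub: "sub_mset G ?Z (A \<union> B)" using A B by (auto simp: sub_mset_def)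
  interpret Y: right_mset G ?Y using sub by (rule Z.right_mset_restrict)
  have "indecomposable G ?Y"
    using ind[OF Z.right_mset_axioms indecomposable_regular[OF \<iota>] sub] ab by blast
  then have "(a, b) \<in> conn_rel G ?Y"
    using ab unfolding Y.indecomposable_iff_conn_rel by (simp add: restrict_mset_def)
  then show "A \<inter> B \<noteq> {}" by (rule Z.restrict_Un_conn_relD[OF A B ab])
qed

lemma copunctually_locally_connected_imp_Ore:
  fixes \<iota> :: "'a \<Rightarrow> 'u"
  assumes clc: "copunctually_locally_connected TYPE('u) G" and \<iota>: "inj_on \<iota> (carrier G)"
  shows "right_Ore G"
  unfolding right_Ore_iff_principal_ideals_meet
proof (intro ballI notI)
  fix p q assume pq: "p \<in> carrier G" "q \<in> carrier G"
    and disj: "principal_ideal G p \<inter> principal_ideal G q = {}"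
  let ?P = "principal_ideal G p" and ?Q = "principal_ideal G q"
  have P: "right_ideal G ?P" "p \<in> ?P" and Q: "right_ideal G ?Q" "q \<in> ?Q"
    using pq right_ideal_principal principal_ideal_self by auto
  \<comment> \<open>The quotient of the regular M-set collapsing \<open>?P\<close> and
    \<open>?Q\<close> is modelled on chosen representatives, \<open>p\<close> for \<open>?P\<close>
    and \<open>q\<close> for \<open>?Q\<close>, which keeps its elements in
    \<open>'u\<close>.\<close>
  define rep where "rep x = (if x \<in> ?P then p else if x \<in> ?Q then q else x)" for x
  define Y where "Y = \<lparr>carrier = \<iota> ` rep ` carrier G,
    ract = (\<lambda>u m. \<iota> (rep (inv_into (carrier G) \<iota> u \<otimes> m)))\<rparr>"
  have rep: "rep x \<in> carrier G" if "x \<in> carrier G" for x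
    using that pq by (simp add: rep_def)
  \<comment> \<open>The collapse is compatible with the action because \<open>?P\<close> and
    \<open>?Q\<close> are disjoint right ideals; the action laws of \<open>Y\<close> rest on
    this.\<close>
  have rep_mult: "rep (rep x \<otimes> m) = rep (x \<otimes> m)" if "m \<in> carrier G" for x m
    using that P Q disj by (auto simp: rep_def right_ideal_def)
  have carrier_Y: "carrier Y = \<iota> ` rep ` carrier G" by (simp add: Y_def)
  have act: "ract Y (\<iota> (rep x)) m = \<iota> (rep (x \<otimes> m))" if "x \<in> carrier G" "m \<in> carrier G" for x m
    using that \<iota> rep rep_mult by (simp add: Y_def)
  interpret Y: right_mset G Y
    by unfold_locales (auto simp: carrier_Y act m_assoc)
  have rp: "rep x = p" if "x \<in> ?P" for x using that by (simp add: rep_def)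
  have rq: "rep x = q" if "x \<in> ?Q" for x using that disj by (auto simp: rep_def)
  have "ract Y (\<iota> p) m = \<iota> p" "ract Y (\<iota> q) m = \<iota> q" if m: "m \<in> carrier G" for m
  proof -
    have "p \<otimes> m \<in> ?P" "q \<otimes> m \<in> ?Q" using m by (simp_all add: principal_ideal_def)
    then show "ract Y (\<iota> p) m = \<iota> p" "ract Y (\<iota> q) m = \<iota> q"
      using act[OF pq(1) m] act[OF pq(2) m] by (simp_all add: rp rq P(2) Q(2))
  qed
  moreover have "\<iota> p \<in> carrier Y" "\<iota> q \<in> carrier Y"
    unfolding carrier_Y using pq rp[OF P(2)] rq[OF Q(2)] by (metis imageI)+
  ultimately have fixed: "\<iota> p \<in> global_sections G Y" "\<iota> q \<in> global_sections G Y"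
    by (simp_all add: global_sections_def)
  \<comment> \<open>As a quotient of the regular M-set, \<open>Y\<close> is generated by the image
    of the unit and hence connected.\<close>
  have "(\<iota> (rep \<one>), \<iota> (rep x)) \<in> conn_rel G Y" if "x \<in> carrier G" for x
    using Y.conn_rel_ract[of "\<iota> (rep \<one>)" x] that by (simp add: act carrier_Y)
  then have "(\<iota> p, \<iota> q) \<in> conn_rel G Y"
    using pq rp[OF P(2)] rq[OF Q(2)] by (metis conn_rel_sym conn_rel_trans)
  then have "alpha G Y (\<iota> p) = alpha G Y (\<iota> q)"
    unfolding alpha_def by (rule equiv_class_eq[OF equiv_conn_rel])
  then have "\<iota> p = \<iota> q"
    using clc fixed Y.right_mset_axioms
    unfolding copunctually_locally_connected_def by (blast dest: inj_onD)
  then have "p = q" using \<iota> pq by (blast dest: inj_onD)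
  with P Q disj show False by blast
qed

section \<open>Components of the subobject classifier\<close>

lemma ract_Omega: "ract (Omega G) I m = {n \<in> carrier G. m \<otimes> n \<in> I}"
  by (simp add: Omega_def)

lemma carrier_Omega: "carrier (Omega G) = {I. right_ideal G I}"
  by (simp add: Omega_def)

lemma right_ideal_empty: "right_ideal G {}"
  by (simp add: right_ideal_def)

lemma right_ideal_carrier: "right_ideal G (carrier G)"
  by (simp add: right_ideal_def)

text \<open>Any element of a right ideal moves that ideal to the whole monoid. Thus
  \<open>Omega G\<close> has at most two components, those of the full and of the empty
  ideal.\<close>

lemma conn_rel_Omega_carrier:
  assumes "right_ideal G I" and "I \<noteq> {}"
  shows "(I, carrier G) \<in> conn_rel G (Omega G)"
proof -
  interpret O: right_mset G "Omega G" by (rule right_mset_Omega)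
  obtain m where "m \<in> I" using assms by blast
  then have "m \<in> carrier G" "ract (Omega G) I m = carrier G"
    using assms by (auto simp: right_ideal_def ract_Omega)
  with assms(1) show ?thesis using O.conn_rel_ract[of I m] by (simp add: carrier_Omega)
qed

lemma components_Omega:
  "components G (Omega G) = {conn_rel G (Omega G) `` {carrier G}, conn_rel G (Omega G) `` {{}}}"
proof -
  let ?r = "conn_rel G (Omega G)"
  have "?r `` {I} = ?r `` {carrier G}" if "right_ideal G I" "I \<noteq> {}" for I
    using conn_rel_Omega_carrier[OF that] by (rule equiv_class_eq[OF equiv_conn_rel])
  then have "?r `` {I} \<in> {?r `` {carrier G}, ?r `` {{}}}" if "right_ideal G I" for I
    using that by blast
  then show ?thesis
    unfolding components_def quotient_def carrier_Omega
    using right_ideal_empty right_ideal_carrier by fast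
qed

text \<open>The full and the empty ideal are distinct fixed points, so under Ore they have no common
  translate. Without Ore, a principal ideal disjoint from another one is connected to both.\<close>

lemma right_Ore_iff_conn_rel_Omega: "right_Ore G \<longleftrightarrow> (carrier G, {}) \<notin> conn_rel G (Omega G)"
proof
  interpret O: right_mset G "Omega G" by (rule right_mset_Omega)
  assume ore: "right_Ore G"
  show "(carrier G, {}) \<notin> conn_rel G (Omega G)"
  proof
    assume "(carrier G, {}) \<in> conn_rel G (Omega G)"
    then obtain m n where "m \<in> carrier G" "ract (Omega G) (carrier G) m = ract (Omega G) {} n"
      unfolding O.conn_rel_iff_Ore[OF ore] by blast
    then have "carrier G = {}" by (simp add: ract_Omega)
    then show False by (metis one_closed empty_iff)
  qed
next
  interpret O: right_mset G "Omega G" by (rule right_mset_Omega)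
  assume nconn: "(carrier G, {}) \<notin> conn_rel G (Omega G)"
  show "right_Ore G"
    unfolding right_Ore_iff_principal_ideals_meet
  proof (intro ballI notI)
    fix p q assume pq: "p \<in> carrier G" "q \<in> carrier G"
      and disj: "principal_ideal G p \<inter> principal_ideal G q = {}"
    let ?P = "principal_ideal G p"
    have P: "right_ideal G ?P" "?P \<noteq> {}"
      using pq right_ideal_principal principal_ideal_self by auto
    \<comment> \<open>An element \<open>n\<close> of this ideal would put
      \<open>q \<otimes> n\<close> into both principal ideals.\<close>
    have "ract (Omega G) ?P q = {}"
      using disj by (auto simp: ract_Omega principal_ideal_def)
    then have "(?P, {}) \<in> conn_rel G (Omega G)"
      using O.conn_rel_ract[of ?P q] P pq by (simp add: carrier_Omega)
    then show False
      using nconn conn_rel_Omega_carrier[OF P] by (metis conn_rel_sym conn_rel_trans)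
  qed
qed

lemma right_Ore_iff_card_components_Omega: "right_Ore G \<longleftrightarrow> card (components G (Omega G)) = 2"
proof -
  let ?r = "conn_rel G (Omega G)"
  have "(carrier G, {}) \<in> ?r \<longleftrightarrow> ?r `` {carrier G} = ?r `` {{}}"
    using eq_equiv_class_iff[OF equiv_conn_rel, of "carrier G" "Omega G" "{}" G]
    by (simp add: carrier_Omega right_ideal_empty right_ideal_carrier)
  then show ?thesis
    unfolding right_Ore_iff_conn_rel_Omega components_Omega by (auto simp: card_2_iff')
qed

lemma components_map_Omega_true:
  "components_map G (Omega G) (Omega_true G) ` components G terminal_right =
   {conn_rel G (Omega G) `` {carrier G}}"
proof -
  have "conn_rel G (terminal_right :: (unit, 'a) right_act) = {((), ())}"
    using equiv_conn_rel[of "terminal_right :: (unit, 'a) right_act" G]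
    by (auto simp: equiv_def refl_on_def terminal_right_def)
  moreover have "carrier (terminal_right :: (unit, 'a) right_act) = {()}"
    by (simp add: terminal_right_def)
  ultimately have "components G (terminal_right :: (unit, 'a) right_act) = {{()}}"
    by (auto simp: components_def quotient_def)
  then show ?thesis by (simp add: components_map_def Omega_true_def)
qed

text \<open>The classifying map tests whether a component is that of the full ideal. It takes both
  truth values exactly when the component of the empty ideal is a different one.\<close>

lemma components_preserves_subobject_classifier_iff:
  "components_preserves_subobject_classifier TYPE('u) G \<longleftrightarrow>
   components_preserves_monos TYPE('u) G \<and> card (components G (Omega G)) = 2"
proof -
  let ?a = "conn_rel G (Omega G) `` {carrier G}" and ?b = "conn_rel G (Omega G) `` {{}}"
  have "bij_betw (\<lambda>c. c \<in> {?a}) {?a, ?b} (UNIV :: bool set) \<longleftrightarrow> card {?a, ?b} = 2"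
  proof
    assume "bij_betw (\<lambda>c. c \<in> {?a}) {?a, ?b} (UNIV :: bool set)"
    then show "card {?a, ?b} = 2" using bij_betw_same_card by fastforce
  next
    assume "card {?a, ?b} = 2"
    then have "?a \<noteq> ?b" by auto
    then show "bij_betw (\<lambda>c. c \<in> {?a}) {?a, ?b} (UNIV :: bool set)"
      by (auto simp: bij_betw_def inj_on_def UNIV_bool)
  qed
  then show ?thesis
    unfolding components_preserves_subobject_classifier_def components_map_Omega_true
      components_Omega by blast
qed

section \<open>The de Morgan law for right ideals\<close>

text \<open>Under Ore a non-empty ideal meets every principal ideal, so its negation is empty and
  its double negation is everything.\<close>

lemma right_Ore_iff_de_Morgan: "right_Ore G \<longleftrightarrow> de_Morgan_topos G"
proof
  assume ore: "right_Ore G"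
  show "de_Morgan_topos G"
    unfolding de_Morgan_topos_def carrier_Omega
  proof (intro ballI, elim CollectE)
    fix I assume I: "right_ideal G I"
    show "Omega_imp G I {} \<union> Omega_imp G (Omega_imp G I {}) {} = carrier G"
    proof (cases "I = {}")
      case True
      then show ?thesis by (auto simp: Omega_imp_def)
    next
      case False
      then obtain i where i: "i \<in> I" by blast
      have "Omega_imp G I {} = {}"
      proof (rule equals0I)
        fix m assume m: "m \<in> Omega_imp G I {}"
        then have "m \<in> carrier G" "i \<in> carrier G"
          using i I by (auto simp: Omega_imp_def right_ideal_def)
        then obtain k l where "k \<in> carrier G" "l \<in> carrier G" "m \<otimes> k = i \<otimes> l"
          using right_OreE[OF ore] by metis
        with m i I show False by (auto simp: Omega_imp_def right_ideal_def)
      qed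
      then show ?thesis by (auto simp: Omega_imp_def)
    qed
  qed
next
  assume dM: "de_Morgan_topos G"
  show "right_Ore G"
    unfolding right_Ore_iff_principal_ideals_meet
  proof (intro ballI notI)
    fix p q assume pq: "p \<in> carrier G" "q \<in> carrier G"
      and disj: "principal_ideal G p \<inter> principal_ideal G q = {}"
    let ?P = "principal_ideal G p"
    \<comment> \<open>The unit can lie in neither part: its translate \<open>p\<close> is in
      \<open>?P\<close>, and its translate \<open>q\<close> is in the negation of
      \<open>?P\<close>.\<close>
    have "\<one> \<in> Omega_imp G ?P {} \<union> Omega_imp G (Omega_imp G ?P {}) {}"
      using dM right_ideal_principal[OF pq(1)] by (simp add: de_Morgan_topos_def carrier_Omega)
    moreover have "\<one> \<notin> Omega_imp G ?P {}"
      using pq principal_ideal_self by (auto simp: Omega_imp_def)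
    moreover have "q \<in> Omega_imp G ?P {}"
      using pq disj by (auto simp: Omega_imp_def principal_ideal_def)
    ultimately show False using pq by (auto simp: Omega_imp_def)
  qed
qed

end

theorem theorem2p31:
  fixes M :: "('m, 'k) monoid_scheme" and \<iota> :: "'m \<Rightarrow> 'u"
  assumes "monoid M"
    and "inj_on \<iota> (carrier M)"
  shows
    "(components_preserves_monos TYPE('u) M \<longleftrightarrow> mono_flat TYPE('u) M terminal_left) \<and>
     (components_preserves_monos TYPE('u) M \<longleftrightarrow>
       (\<forall>(X :: ('u, 'm) right_act) A B.
          right_mset M X \<and> indecomposable M X \<and>
          sub_mset M X A \<and> A \<noteq> {} \<and> sub_mset M X B \<and> B \<noteq> {} \<longrightarrow> A \<inter> B \<noteq> {})) \<and>
     (components_preserves_monos TYPE('u) M \<longleftrightarrow> right_Ore M) \<and>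
     (components_preserves_monos TYPE('u) M \<longleftrightarrow>
       (\<forall>(X :: ('u, 'm) right_act) A.
          right_mset M X \<and> indecomposable M X \<and> sub_mset M X A \<longrightarrow>
          A = {} \<or> indecomposable M (restrict_mset X A))) \<and>
     (components_preserves_monos TYPE('u) M \<longleftrightarrow> card (components M (Omega M)) = 2) \<and>
     (components_preserves_monos TYPE('u) M \<longleftrightarrow> de_Morgan_topos M) \<and>
     (components_preserves_monos TYPE('u) M \<longleftrightarrow> copunctually_locally_connected TYPE('u) M) \<and>
     (components_preserves_monos TYPE('u) M \<and> card (components M (Omega M)) = 2 \<longleftrightarrow>
       components_preserves_subobject_classifier TYPE('u) M)"
proof -
  interpret monoid M by fact
  note \<iota> = assms(2)
  \<comment> \<open>The Ore condition is the hub: conditions (1), (2), (4), (5), (6) and (7) are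
    each compared with it, and the stated equivalences follow propositionally.\<close>
  have 1: "components_preserves_monos TYPE('u) M \<longleftrightarrow> right_Ore M"
    using components_preserves_monos_imp_Ore[OF _ \<iota>] Ore_imp_components_preserves_monos[OF _ \<iota>]
    by blast
  have 2: "right_Ore M \<longleftrightarrow> (\<forall>(X :: ('u, 'm) right_act) A B.
      right_mset M X \<and> indecomposable M X \<and>
      sub_mset M X A \<and> A \<noteq> {} \<and> sub_mset M X B \<and> B \<noteq> {} \<longrightarrow> A \<inter> B \<noteq> {})" (is "_ \<longleftrightarrow> ?R")
  proof
    assume R: ?R
    show "right_Ore M"
    proof (rule right_OreI_regular[OF \<iota>])
      fix A B a b
      assume "sub_mset M (regular_mset M \<iota>) A" "sub_mset M (regular_mset M \<iota>) B" "a \<in> A" "b \<in> B"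
      with R right_mset_regular[OF \<iota>] indecomposable_regular[OF \<iota>] show "A \<inter> B \<noteq> {}" by blast
    qed
  qed (blast dest: right_mset.Ore_imp_sub_msets_meet)
  have 4: "right_Ore M \<longleftrightarrow> (\<forall>(X :: ('u, 'm) right_act) A.
      right_mset M X \<and> indecomposable M X \<and> sub_mset M X A \<longrightarrow>
      A = {} \<or> indecomposable M (restrict_mset X A))" (is "_ \<longleftrightarrow> ?R")
  proof
    show "?R \<Longrightarrow> right_Ore M" by (rule indecomposable_restrict_imp_Ore[OF _ \<iota>]) blast
  qed (blast dest: right_mset.Ore_imp_indecomposable_restrict)
  have 7: "right_Ore M \<longleftrightarrow> copunctually_locally_connected TYPE('u) M"
  proof
    show "right_Ore M \<Longrightarrow> copunctually_locally_connected TYPE('u) M"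
      unfolding copunctually_locally_connected_def by (blast intro: right_mset.Ore_imp_inj_on_alpha)
  qed (rule copunctually_locally_connected_imp_Ore[OF _ \<iota>])
  show ?thesis
    using 1 2 4 7 mono_flat_terminal_left_iff[OF \<open>monoid M\<close>, where 'u = 'u]
      right_Ore_iff_card_components_Omega right_Ore_iff_de_Morgan
      components_preserves_subobject_classifier_iff[where 'u = 'u]
    by (intro conjI) argo+
qed

end
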